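(* Let $r\ge 2$ be an integer and let $H$ be a $\{1,r\}$-graph on a finite vertex set $[n]$ (every edge of $H$ has cardinality $1$ or $r$). Suppose that the order of a maximum complete $\{1,r\}$-subgraph of $H$ equals $t$ and that the order of a maximum complete $\{1\}$-subgraph of $H$ also equals $t$, where $$t\geq \left\lceil \frac{[r(r-1)-1]^{r-2}}{[r(r-1)]^{r-3}}\right\rceil .$$ Then $$\lambda'(H)=\lambda'\left(K_t^{\{1,r\}}\right)=1+\frac{\prod_{i=1}^{r-1}(t-i)}{t^{r-1}}.$$
   Context: A hypergraph $H=(V,E)$ has edges that are subsets of $V$; its set of edge types is $R(H)=\{|F|:F\in E\}$, and $H$ is called an $R$-graph if $R(H)=R$. For $j\in R(H)$, $H^j$ (or $E^j$) denotes the set of edges of $H$ of cardinality $j$. The complete hypergraph $K_t^{R}$ has vertex set $[t]$ and edge set $\bigcup_{i\in R}\binom{[t]}{i}$. A complete $R$-subgraph of $H$ of order $t$ is a set $S$ of $t$ vertices such that every subset of $S$ whose cardinality lies in $R$ is an edge of $H$; in particular the order of a maximum complete $\{1\}$-subgraph is the number of $1$-edges of $H$. For $H$ with vertex set $[n]$ and $\vec x\in\mathbb{R}^n$, define $\lambda'(H,\vec x)=\sum_{j\in R(H)} j!\sum_{i_1i_2\ldots i_j\in H^j}x_{i_1}x_{i_2}\cdots x_{i_j}$, and the Lagrangian $\lambda'(H)=\max\{\lambda'(H,\vec x): \vec x\in S\}$, where $S=\{\vec x\in\mathbb{R}^n:\sum_{i=1}^n x_i=1,\ x_i\ge 0\}$.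 *)

theory Defs
  imports "HOL-Analysis.Analysis"
begin

record 'a hypergraph =
  verts :: "'a set"
  edges :: "'a set set"

definition wf_hypergraph :: "'a hypergraph \<Rightarrow> bool" where
  "wf_hypergraph H \<longleftrightarrow> edges H \<subseteq> Pow (verts H)"

definition edge_types :: "'a hypergraph \<Rightarrow> nat set" where
  "edge_types H = card ` edges H"

definition R_graph :: "nat set \<Rightarrow> 'a hypergraph \<Rightarrow> bool" where
  "R_graph R H \<longleftrightarrow> wf_hypergraph H \<and> edge_types H = R"

definition edges_of_size :: "'a hypergraph \<Rightarrow> nat \<Rightarrow> 'a set set" where
  "edges_of_size H j = {F \<in> edges H. card F = j}"

definition complete_hypergraph :: "nat set \<Rightarrow> nat \<Rightarrow> nat hypergraph" where
  "complete_hypergraph R t =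
     \<lparr> verts = {1..t}, edges = (\<Union>i\<in>R. {F. F \<subseteq> {1..t} \<and> card F = i}) \<rparr>"

definition complete_subgraph :: "nat set \<Rightarrow> 'a hypergraph \<Rightarrow> 'a set \<Rightarrow> bool" where
  "complete_subgraph R H S \<longleftrightarrow>
     S \<subseteq> verts H \<and> (\<forall>F. F \<subseteq> S \<and> card F \<in> R \<longrightarrow> F \<in> edges H)"

definition max_complete_order :: "nat set \<Rightarrow> 'a hypergraph \<Rightarrow> nat" where
  "max_complete_order R H = Max {card S | S. complete_subgraph R H S}"

definition lagrange_poly :: "'a hypergraph \<Rightarrow> ('a \<Rightarrow> real) \<Rightarrow> real" where
  "lagrange_poly H x =
     (\<Sum>j\<in>edge_types H. fact j * (\<Sum>F\<in>edges_of_size H j. \<Prod>i\<in>F. x i))"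

text \<open>A weight vector is a function on the whole type; only its values on the vertex set
  matter, so it stands for an element of the Euclidean space indexed by the vertices.\<close>

definition weightings :: "'a set \<Rightarrow> ('a \<Rightarrow> real) set" where
  "weightings V = {x. (\<Sum>i\<in>V. x i) = 1 \<and> (\<forall>i\<in>V. 0 \<le> x i)}"

text \<open>The maximum of an infinite set of reals: \<^const>\<open>Max\<close> is meaningful only for finite sets.
  Existence is \<open>lagrangian_attained\<close> below.\<close>

definition lagrangian :: "'a hypergraph \<Rightarrow> real" where
  "lagrangian H = (GREATEST v. v \<in> lagrange_poly H ` weightings (verts H))"

lemma lagrangian_attained:
  fixes H :: "'a hypergraph"
  assumes fin: "finite (verts H)" and ne: "verts H \<noteq> {}" and wf: "wf_hypergraph H"
  shows "\<exists>x\<in>weightings (verts H). lagrangian H = lagrange_poly H x"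
    and "x \<in> weightings (verts H) \<Longrightarrow> lagrange_poly H x \<le> lagrangian H"
proof -
  let ?V = "verts H"
  define B where "B = (\<lambda>i. if i \<in> ?V then {0..1::real} else {0})"
  define C where "C = PiE UNIV B \<inter> {x. (\<Sum>i\<in>?V. x i) = 1}"
  have cont_nth: "continuous_on UNIV (\<lambda>x :: 'a \<Rightarrow> real. x i)" for i
    by (rule continuous_on_product_coordinates)
  have "compactin (product_topology (\<lambda>i. euclidean) UNIV) (PiE UNIV B)"
    by (subst compactin_PiE) (auto simp: B_def)
  then have "compact (PiE UNIV B)"
    by (simp add: euclidean_product_topology)
  moreover have "closed {x :: 'a \<Rightarrow> real. (\<Sum>i\<in>?V. x i) = 1}"
    by (intro closed_Collect_eq continuous_on_sum cont_nth continuous_on_const)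
  ultimately have comp: "compact C"
    unfolding C_def by (rule compact_Int_closed)
  obtain a where a: "a \<in> ?V" using ne by blast
  have "(\<lambda>i. if i = a then 1 else 0) \<in> C"
    using a fin by (auto simp: C_def B_def PiE_iff)
  then have "C \<noteq> {}" by blast
  moreover have "continuous_on C (lagrange_poly H)"
    unfolding lagrange_poly_def
    by (intro continuous_on_sum continuous_on_mult continuous_on_const continuous_on_prod
        continuous_on_subset[OF cont_nth]) auto
  ultimately obtain m where m: "m \<in> C" "\<And>x. x \<in> C \<Longrightarrow> lagrange_poly H x \<le> lagrange_poly H m"
    using continuous_attains_sup[OF comp] by blast
  have mW: "m \<in> weightings ?V"
    using m(1) by (auto simp: C_def B_def PiE_iff weightings_def split: if_splits)
  have up: "lagrange_poly H x \<le> lagrange_poly H m" if x: "x \<in> weightings ?V" for x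
  proof -
    define y where "y = (\<lambda>i. if i \<in> ?V then x i else 0)"
    have le1: "x i \<le> 1" if "i \<in> ?V" for i
      using member_le_sum[of i ?V x] that x fin by (auto simp: weightings_def)
    have "y \<in> C"
      using x le1 by (auto simp: C_def B_def y_def PiE_iff weightings_def)
    moreover have "lagrange_poly H y = lagrange_poly H x"
      unfolding lagrange_poly_def y_def using wf
      by (intro sum.cong refl arg_cong2[where f = "(*)"] prod.cong)
         (auto simp: edges_of_size_def wf_hypergraph_def)
    ultimately show ?thesis using m(2) by metis
  qed
  have eq: "lagrangian H = lagrange_poly H m"
    unfolding lagrangian_def using mW up by (intro Greatest_equality) auto
  show "\<exists>x\<in>weightings (verts H). lagrangian H = lagrange_poly H x"
    using eq mW by blast
  show "x \<in> weightings (verts H) \<Longrightarrow> lagrange_poly H x \<le> lagrangian H"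
    using eq up by simp
qed

end

theory Submission
  imports Defs
begin

text \<open>
  Let \<open>T\<close> be the set of vertices carrying a 1-edge; the hypotheses say that \<open>|T| = t\<close> and that
  \<open>T\<close> spans a complete subgraph, so uniform weight on \<open>T\<close> gives the lower bound. For the upper
  bound allow all \<open>r\<close>-sets as edges and let \<open>s\<close> be the total weight of \<open>T\<close>. Maclaurin's
  inequality on \<open>T\<close>, and \<open>m! e_m \<le> (1 - s)^m\<close> off \<open>T\<close>, bound the polynomial by
  \<open>s + \<Sum>k\<le>r. c_k (r choose k) s^k (1 - s)^(r - k)\<close> with \<open>c_k = \<Prod>i<k. 1 - i / t\<close>. The threshold
  on \<open>t\<close> makes every decrement \<open>c_k - c_(k+1) = k c_k / t\<close> with \<open>k < r\<close> at most \<open>1 / r\<close>, so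
  \<open>c_k \<le> c_r + (r - k) / r\<close>; since the binomial distribution has mean \<open>r s\<close>, the bound is at
  most \<open>s + c_r + (1 - s) = 1 + c_r\<close>.
\<close>

section \<open>Elementary symmetric polynomials over finite sets\<close>

definition elem_sym :: "'a set \<Rightarrow> nat \<Rightarrow> ('a \<Rightarrow> real) \<Rightarrow> real" where
  "elem_sym A k x = (\<Sum>F | F \<subseteq> A \<and> card F = k. \<Prod>i\<in>F. x i)"

lemma elem_sym_0: "finite A \<Longrightarrow> elem_sym A 0 x = 1"
proof -
  assume "finite A"
  then have "{F. F \<subseteq> A \<and> card F = 0} = {{}}"
    by (auto dest: finite_subset)
  then show ?thesis
    by (simp add: elem_sym_def)
qed

lemma elem_sym_nonneg: "(\<And>i. i \<in> A \<Longrightarrow> 0 \<le> x i) \<Longrightarrow> 0 \<le> elem_sym A k x"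
  unfolding elem_sym_def by (intro sum_nonneg prod_nonneg) auto

lemma elem_sym_const:
  assumes "finite A" and "\<And>i. i \<in> A \<Longrightarrow> x i = c"
  shows "elem_sym A k x = real (card A choose k) * c ^ k"
proof -
  have "elem_sym A k x = (\<Sum>F | F \<subseteq> A \<and> card F = k. c ^ k)"
    unfolding elem_sym_def
  proof (intro sum.cong refl)
    fix F assume F: "F \<in> {F. F \<subseteq> A \<and> card F = k}"
    then have "(\<Prod>i\<in>F. x i) = (\<Prod>i\<in>F. c)"
      using assms(2) by (intro prod.cong) auto
    then show "(\<Prod>i\<in>F. x i) = c ^ k"
      using F by simp
  qed
  then show ?thesis
    using assms(1) by (simp add: n_subsets)
qed

text \<open>Pascal's rule with weights: the subsets are sorted by whether they contain
  \<open>a\<close>.\<close>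

lemma elem_sym_insert:
  assumes fin: "finite A" and a: "a \<notin> A"
  shows "elem_sym (insert a A) (Suc k) x = elem_sym A (Suc k) x + x a * elem_sym A k x"
proof -
  let ?S = "\<lambda>k. {F. F \<subseteq> A \<and> card F = k}"
  have fS: "finite (?S k)" for k
    using fin by auto
  have split: "{F. F \<subseteq> insert a A \<and> card F = Suc k} = ?S (Suc k) \<union> insert a ` ?S k"
  proof (intro equalityI subsetI)
    fix F assume F: "F \<in> {F. F \<subseteq> insert a A \<and> card F = Suc k}"
    then have finF: "finite F" using fin by (auto dest: finite_subset)
    show "F \<in> ?S (Suc k) \<union> insert a ` ?S k"
    proof (cases "a \<in> F")
      case True
      then have "F = insert a (F - {a})" "F - {a} \<in> ?S k"
        using F finF by auto
      then show ?thesis by blast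
    qed (use F in auto)
  next
    fix F assume "F \<in> ?S (Suc k) \<union> insert a ` ?S k"
    then show "F \<in> {F. F \<subseteq> insert a A \<and> card F = Suc k}"
      using a fin by (auto simp: card_insert_if finite_subset)
  qed
  have inj: "inj_on (insert a) (?S k)"
    using a by (auto simp: inj_on_def)
  have "(\<Sum>F\<in>insert a ` ?S k. \<Prod>i\<in>F. x i) = (\<Sum>F\<in>?S k. \<Prod>i\<in>insert a F. x i)"
    by (simp add: sum.reindex[OF inj])
  also have "\<dots> = (\<Sum>F\<in>?S k. x a * (\<Prod>i\<in>F. x i))"
  proof (intro sum.cong refl)
    fix F assume "F \<in> ?S k"
    then have "finite F" "a \<notin> F" using fin a by (auto dest: finite_subset)
    then show "(\<Prod>i\<in>insert a F. x i) = x a * (\<Prod>i\<in>F. x i)" by simp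
  qed
  also have "\<dots> = x a * elem_sym A k x"
    by (simp add: elem_sym_def sum_distrib_left)
  finally have 1: "(\<Sum>F\<in>insert a ` ?S k. \<Prod>i\<in>F. x i) = x a * elem_sym A k x" .
  have "elem_sym (insert a A) (Suc k) x
      = (\<Sum>F\<in>?S (Suc k). \<Prod>i\<in>F. x i) + (\<Sum>F\<in>insert a ` ?S k. \<Prod>i\<in>F. x i)"
    unfolding elem_sym_def split
    by (rule sum.union_disjoint) (use fS a in auto)
  then show ?thesis
    using 1 by (simp add: elem_sym_def)
qed

text \<open>A weighted Vandermonde identity: a subset of a disjoint union is determined by its
  traces on \<open>A\<close> and \<open>B\<close>. It separates the vertices carrying a 1-edge from
  the rest.\<close>

lemma elem_sym_Un:
  assumes "finite A" and "finite B" and "A \<inter> B = {}"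
  shows "elem_sym (A \<union> B) r x = (\<Sum>k\<le>r. elem_sym A k x * elem_sym B (r - k) x)"
proof -
  let ?S = "\<lambda>A k. {F. F \<subseteq> A \<and> card F = k}"
  have fin: "finite (?S A k)" "finite (?S B k)" for k
    using assms by auto
  have card_split: "card F = card (F \<inter> A) + card (F \<inter> B)" if "F \<subseteq> A \<union> B" for F
  proof -
    have "F = (F \<inter> A) \<union> (F \<inter> B)" using that by blast
    then show ?thesis
      using assms card_Un_disjoint[of "F \<inter> A" "F \<inter> B"]
      by (metis finite_Int inf_bot_right inf_commute inf_left_commute)
  qed
  have "(\<Sum>k\<le>r. elem_sym A k x * elem_sym B (r - k) x)
      = (\<Sum>k\<le>r. \<Sum>(F, G)\<in>?S A k \<times> ?S B (r - k). (\<Prod>i\<in>F. x i) * (\<Prod>i\<in>G. x i))"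
    by (simp add: elem_sym_def sum_product sum.cartesian_product)
  also have "\<dots> = (\<Sum>(k, F, G)\<in>(SIGMA k:{..r}. ?S A k \<times> ?S B (r - k)). (\<Prod>i\<in>F. x i) * (\<Prod>i\<in>G. x i))"
    by (rule sum.Sigma) (use fin in auto)
  also have "\<dots> = (\<Sum>F\<in>?S (A \<union> B) r. \<Prod>i\<in>F. x i)"
  proof (rule sum.reindex_bij_witness
      [where j = "\<lambda>(k, F, G). F \<union> G" and i = "\<lambda>F. (card (F \<inter> A), F \<inter> A, F \<inter> B)"])
    fix p assume p: "p \<in> (SIGMA k:{..r}. ?S A k \<times> ?S B (r - k))"
    obtain k F G where pk: "p = (k, F, G)" by (metis prod.exhaust)
    have FG: "k \<le> r" "F \<subseteq> A" "card F = k" "G \<subseteq> B" "card G = r - k"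
      using p pk by auto
    then have f: "finite F" "finite G" "F \<inter> G = {}"
      using assms by (auto dest: finite_subset)
    have int: "(F \<union> G) \<inter> A = F" "(F \<union> G) \<inter> B = G"
      using FG assms(3) by auto
    show "(\<lambda>F. (card (F \<inter> A), F \<inter> A, F \<inter> B)) ((\<lambda>(k, F, G). F \<union> G) p) = p"
      using int FG by (simp add: pk)
    show "(\<lambda>(k, F, G). F \<union> G) p \<in> ?S (A \<union> B) r"
      using FG f by (auto simp: pk card_Un_disjoint)
    show "(\<Prod>i\<in>(\<lambda>(k, F, G). F \<union> G) p. x i)
        = (case p of (k, F, G) \<Rightarrow> (\<Prod>i\<in>F. x i) * (\<Prod>i\<in>G. x i))"
      using f by (simp add: pk prod.union_disjoint)
  next
    fix F assume F: "F \<in> ?S (A \<union> B) r"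
    then show "(\<lambda>(k, F, G). F \<union> G) ((\<lambda>F. (card (F \<inter> A), F \<inter> A, F \<inter> B)) F) = F"
      by auto
    show "(\<lambda>F. (card (F \<inter> A), F \<inter> A, F \<inter> B)) F \<in> (SIGMA k:{..r}. ?S A k \<times> ?S B (r - k))"
      using F card_split[of F] by auto
  qed
  finally show ?thesis
    by (simp add: elem_sym_def)
qed

section \<open>Maclaurin's inequality and a consequence free of the cardinality\<close>

text \<open>As a function of \<open>m\<close>, the power \<open>m ^ Suc k\<close> lies above its
  tangent at \<open>m = a\<close>. This is the one-variable core of Maclaurin's inequality.\<close>

lemma power_ge_tangent:
  fixes a m :: real
  assumes "0 \<le> a" and "0 \<le> m"
  shows "real (Suc k) * m * a ^ k \<le> real k * a ^ Suc k + m ^ Suc k"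
proof (induction k)
  case 0
  then show ?case by simp
next
  case (Suc k)
  \<comment> \<open>Both factors have the same sign. Adding this product to \<open>a\<close> times
    the induction hypothesis cancels the mixed term \<open>a * m ^ Suc k\<close>.\<close>
  have "0 \<le> (a - m) * (a ^ Suc k - m ^ Suc k)"
  proof (cases "a \<le> m")
    case True
    then have "a ^ Suc k \<le> m ^ Suc k" using assms by (intro power_mono)
    then show ?thesis using True by (intro mult_nonpos_nonpos) auto
  next
    case False
    then have "m ^ Suc k \<le> a ^ Suc k" using assms by (intro power_mono) auto
    then show ?thesis using False by (intro mult_nonneg_nonneg) auto
  qed
  moreover have "a * (real (Suc k) * m * a ^ k) \<le> a * (real k * a ^ Suc k + m ^ Suc k)"
    using Suc.IH assms(1) by (rule mult_left_mono)
  ultimately show ?case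
    by (simp add: algebra_simps)
qed

text \<open>Maclaurin's inequality. For an empty set the mean is the junk value \<open>0 / 0 = 0\<close>,
  which is harmless because \<open>s = card A * (s / card A)\<close> still holds.\<close>

lemma elem_sym_le_mean:
  assumes "finite A" and "\<And>i. i \<in> A \<Longrightarrow> 0 \<le> x i"
  shows "elem_sym A k x \<le> real (card A choose k) * ((\<Sum>i\<in>A. x i) / real (card A)) ^ k"
  using assms
proof (induction A arbitrary: k rule: finite_induct)
  case empty
  show ?case
    using elem_sym_const[of "{}" x 0 k] by simp
next
  case (insert b A)
  let ?t = "card A"
  define a where "a = (\<Sum>i\<in>A. x i) / real ?t"
  define m where "m = (\<Sum>i\<in>insert b A. x i) / real (card (insert b A))"
  have sa: "(\<Sum>i\<in>A. x i) = real ?t * a"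
    using insert.hyps by (cases "A = {}") (auto simp: a_def)
  have sm: "x b + real ?t * a = real (Suc ?t) * m"
    using insert.hyps by (simp add: m_def sa)
  have nonneg: "0 \<le> a" "0 \<le> m" "0 \<le> x b"
    using insert.prems by (auto simp: a_def m_def intro!: divide_nonneg_nonneg sum_nonneg)
  show ?case
  proof (cases k)
    case 0
    then show ?thesis using insert.hyps by (simp add: elem_sym_0)
  next
    case (Suc j)
    have "elem_sym (insert b A) k x = elem_sym A (Suc j) x + x b * elem_sym A j x"
      using insert.hyps by (simp add: Suc elem_sym_insert)
    also have "\<dots> \<le> real (?t choose Suc j) * a ^ Suc j + x b * (real (?t choose j) * a ^ j)"
      unfolding a_def
      by (intro add_mono mult_left_mono insert.IH insert.prems nonneg(3)) auto
    also have "\<dots> \<le> real (Suc ?t choose Suc j) * m ^ Suc j"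
    proof -
      let ?N = "real (?t choose j)"
      have c1: "real (Suc j) * real (Suc ?t choose Suc j) = real (Suc ?t) * ?N"
        by (metis Suc_times_binomial of_nat_mult)
      have c2: "real (?t choose Suc j) = real (Suc ?t choose Suc j) - ?N"
        by simp
      have xb: "x b = real (Suc ?t) * m - real ?t * a"
        using sm by simp
      \<comment> \<open>Multiplying by \<open>Suc j\<close> turns every binomial coefficient into a
        multiple of \<open>?N\<close>. Eliminating \<open>x b\<close> through the new mean
        \<open>m\<close> then leaves exactly the tangent of the power function at the old mean
        \<open>a\<close>.\<close>
      have "real (Suc j) * (real (?t choose Suc j) * a ^ Suc j + x b * (?N * a ^ j))
          = (real (Suc j) * real (Suc ?t choose Suc j)) * a ^ Suc j
            - real (Suc j) * ?N * a ^ Suc j + real (Suc j) * x b * ?N * a ^ j"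
        unfolding c2 by (simp only: algebra_simps)
      also have "\<dots> = real (Suc ?t) * ?N * (real (Suc j) * m * a ^ j - real j * a ^ Suc j)"
        unfolding c1 xb by (simp add: algebra_simps)
      also have "\<dots> \<le> real (Suc ?t) * ?N * m ^ Suc j"
        using power_ge_tangent[OF nonneg(1,2), of j] by (intro mult_left_mono) auto
      also have "\<dots> = real (Suc j) * (real (Suc ?t choose Suc j) * m ^ Suc j)"
        by (simp only: c1[symmetric] mult.assoc)
      finally show ?thesis
        by (rule mult_left_le_imp_le) simp
    qed
    finally show ?thesis
      using insert.hyps by (simp add: Suc m_def)
  qed
qed

text \<open>Maclaurin's inequality together with \<open>fact k * (n choose k) \<le> n ^ k\<close>.
  It serves the vertices without a 1-edge, whose number is not controlled.\<close>

lemma fact_mult_elem_sym_le: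
  assumes "finite A" and "\<And>i. i \<in> A \<Longrightarrow> 0 \<le> x i"
  shows "fact k * elem_sym A k x \<le> (\<Sum>i\<in>A. x i) ^ k"
proof -
  have nn: "0 \<le> (\<Sum>i\<in>A. x i) / real (card A)"
    using assms by (simp add: sum_nonneg)
  have "fact k * elem_sym A k x
      \<le> fact k * (real (card A choose k) * ((\<Sum>i\<in>A. x i) / real (card A)) ^ k)"
    using elem_sym_le_mean[OF assms] by (intro mult_left_mono) auto
  also have "\<dots> = real (fact k * (card A choose k)) * ((\<Sum>i\<in>A. x i) / real (card A)) ^ k"
    by simp
  also have "\<dots> \<le> real (card A ^ k) * ((\<Sum>i\<in>A. x i) / real (card A)) ^ k"
    using nn binomial_fact_pow[of "card A" k]
    by (intro mult_right_mono) (auto simp: mult.commute simp del: of_nat_mult of_nat_power)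
  also have "\<dots> = (real (card A) * ((\<Sum>i\<in>A. x i) / real (card A))) ^ k"
    by (simp only: power_mult_distrib of_nat_power)
  also have "real (card A) * ((\<Sum>i\<in>A. x i) / real (card A)) = (\<Sum>i\<in>A. x i)"
    using assms(1) by (cases "A = {}") auto
  finally show ?thesis .
qed

section \<open>Normalised falling factorials\<close>

text \<open>For \<open>t > 0\<close> this is t (t - 1) ... (t - k + 1) / t^k, the \<open>c_k\<close>
  of the overview. In the product form the decrement from \<open>k\<close> to \<open>Suc k\<close>
  is visibly \<open>k / t\<close> times the value at \<open>k\<close>.\<close>

definition falling_ratio :: "nat \<Rightarrow> nat \<Rightarrow> real" where
  "falling_ratio t k = (\<Prod>i<k. 1 - real i / real t)"

text \<open>Rewrites \<open>fact k\<close> times Maclaurin's bound for \<open>t\<close> points of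
  total weight \<open>s\<close>.\<close>

lemma falling_ratio_eq_binomial:
  assumes "t > 0"
  shows "fact k * real (t choose k) * (s / real t) ^ k = falling_ratio t k * s ^ k"
proof -
  have "fact k * real (t choose k) = (\<Prod>i<k. real t - real i)"
    by (simp add: binomial_gbinomial gbinomial_mult_fact lessThan_atLeast0)
  also have "\<dots> = (\<Prod>i<k. real t * (1 - real i / real t))"
    using assms by (intro prod.cong) (auto simp: field_simps)
  also have "\<dots> = real t ^ k * falling_ratio t k"
    by (simp add: falling_ratio_def prod.distrib)
  finally show ?thesis
    using assms by (simp add: power_divide)
qed

lemma falling_ratio_bounds:
  assumes "k \<le> t"
  shows "0 \<le> falling_ratio t k" and "falling_ratio t k \<le> 1"
  using assms unfolding falling_ratio_def
  by (auto intro!: prod_nonneg prod_le_1 simp: divide_le_eq_1)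

text \<open>The factor for \<open>i = 0\<close> is 1, so only \<open>r - 1\<close> factors and as
  many denominators remain.\<close>

lemma falling_ratio_eq_prod:
  assumes "r \<ge> 1" and "t > 0"
  shows "falling_ratio t r = (\<Prod>i=1..r - 1. real t - real i) / real t ^ (r - 1)"
proof -
  obtain q where q: "r = Suc q" using assms(1) by (cases r) auto
  have "falling_ratio t r = (\<Prod>i<q. 1 - real (Suc i) / real t)"
    unfolding q falling_ratio_def prod.lessThan_Suc_shift by simp
  also have "\<dots> = (\<Prod>i=1..q. 1 - real i / real t)"
    by (rule prod.reindex_bij_witness[where i = "\<lambda>i. i - 1" and j = Suc]) auto
  also have "\<dots> = (\<Prod>i=1..q. (real t - real i) / real t)"
    using assms(2) by (intro prod.cong) (auto simp: field_simps)
  finally show ?thesis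
    by (simp add: q prod_dividef)
qed

section \<open>The threshold on \<open>t\<close> and its effect on the decrements\<close>

context
  fixes r t :: nat and q :: real
  assumes r: "r \<ge> 2" and q: "q = real r * (real r - 1)"
    and threshold: "q * (1 - 1 / q) ^ (r - 2) \<le> real t"
begin

text \<open>Bernoulli's inequality for the power of \<open>1 - 1 / q\<close>. This weaker polynomial
  bound suffices for every decrement but the last.\<close>

lemma threshold_lower_bound: "q - real (r - 2) \<le> real t"
proof -
  have q2: "q \<ge> 2"
    using r mult_mono[of 2 "real r" 1 "real r - 1"] by (simp add: q)
  then have "1 + real (r - 2) * (- 1 / q) \<le> (1 + - 1 / q) ^ (r - 2)"
    by (intro Bernoulli_inequality) (simp add: field_simps)
  then have "q * (1 + real (r - 2) * (- 1 / q)) \<le> q * (1 + - 1 / q) ^ (r - 2)"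
    using q2 by (intro mult_left_mono) auto
  also have "\<dots> \<le> real t"
    using threshold by simp
  also have "q * (1 + real (r - 2) * (- 1 / q)) = q - real (r - 2)"
    using q2 by (simp add: field_simps)
  finally show ?thesis .
qed

lemma threshold_ge: "r \<le> t"
proof -
  \<comment> \<open>This product is exactly the excess of \<open>q - (r - 2)\<close> over
    \<open>r\<close>.\<close>
  have "0 \<le> (real r - 1) * (real r - 2)"
    using r by (intro mult_nonneg_nonneg) auto
  then have "real r \<le> q - real (r - 2)"
    using r by (simp add: q of_nat_diff algebra_simps)
  then show ?thesis
    using threshold_lower_bound by linarith
qed

text \<open>The claim amounts to \<open>r * k * falling_ratio t k \<le> t\<close>. For
  \<open>k \<le> r - 2\<close> the ratio may be bounded by 1. For \<open>k = r - 1\<close> the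
  coefficient \<open>r * k\<close> equals \<open>q\<close>, which may exceed \<open>t\<close>, and
  there the threshold is needed in full.\<close>

lemma falling_ratio_decrement_le:
  assumes k: "k < r"
  shows "falling_ratio t k - falling_ratio t (Suc k) \<le> 1 / real r"
proof -
  have t: "t > 0" using threshold_ge r by linarith
  have q2: "q \<ge> 2"
    using r mult_mono[of 2 "real r" 1 "real r - 1"] by (simp add: q)
  have kt: "k \<le> t" using k threshold_ge by linarith
  have "real r * real k * falling_ratio t k \<le> real t"
  proof (cases "k = r - 1")
    case False
    have "real r * real k * falling_ratio t k \<le> real r * real k * 1"
      using falling_ratio_bounds[OF kt] by (intro mult_left_mono) auto
    also have "\<dots> \<le> real r * (real r - 2)"
      using False k r by auto
    \<comment> \<open>The right-hand side is larger by exactly 2.\<close>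
    also have "\<dots> \<le> q - real (r - 2)"
      using r by (simp add: q of_nat_diff algebra_simps)
    finally show ?thesis using threshold_lower_bound by linarith
  next
    case True
    have rk: "real r * real k = q" using True r by (simp add: q of_nat_diff)
    show ?thesis
    proof (cases "q \<le> real t")
      case True
      have "q * falling_ratio t k \<le> q * 1"
        using falling_ratio_bounds[OF kt] q2 by (intro mult_left_mono) auto
      then show ?thesis using True rk by simp
    next
      case False
      \<comment> \<open>The factor for \<open>i = 0\<close> is dropped. Since \<open>t < q\<close>,
        each of the other \<open>r - 2\<close> factors is at most \<open>1 - 1 / q\<close>, which
        produces the power in the threshold.\<close>
      have "falling_ratio t k = (\<Prod>i<Suc (r - 2). 1 - real i / real t)"
        using \<open>k = r - 1\<close> r Suc_diff_le[of 2 r] by (simp add: falling_ratio_def del: prod.lessThan_Suc)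
      also have "\<dots> = (\<Prod>i<r - 2. 1 - real (Suc i) / real t)"
        by (simp only: prod.lessThan_Suc_shift) simp
      also have "\<dots> \<le> (\<Prod>i<r - 2. 1 - 1 / q)"
      proof (intro prod_mono conjI)
        fix i assume "i \<in> {..<r - 2}"
        then have "Suc i \<le> t" using threshold_ge by simp
        then show "0 \<le> 1 - real (Suc i) / real t" using t by (simp add: field_simps)
        have "1 / q \<le> 1 / real t"
          using False t by (intro divide_left_mono) (use q2 in auto)
        also have "\<dots> \<le> real (Suc i) / real t"
          by (intro divide_right_mono) auto
        finally show "1 - real (Suc i) / real t \<le> 1 - 1 / q" by simp
      qed
      also have "\<dots> = (1 - 1 / q) ^ (r - 2)" by simp
      finally have "q * falling_ratio t k \<le> q * (1 - 1 / q) ^ (r - 2)"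
        using q2 by (intro mult_left_mono) auto
      then show ?thesis unfolding rk using threshold by (rule order_trans)
    qed
  qed
  then show ?thesis
    using t r by (simp add: falling_ratio_def field_simps)
qed

text \<open>Downward induction from \<open>k = r\<close> adds up \<open>r - k\<close> decrements. A
  bound affine in \<open>k\<close> can be averaged knowing only the mean of
  \<open>k\<close>.\<close>

lemma falling_ratio_le_affine:
  assumes "k \<le> r"
  shows "falling_ratio t k \<le> falling_ratio t r + (real r - real k) / real r"
  using assms
proof (induction k rule: inc_induct)
  case base
  then show ?case by simp
next
  case (step k)
  have "(real r - real k) / real r = (real r - real (Suc k)) / real r + 1 / real r"
    by (simp add: diff_divide_distrib add_divide_distrib)
  then show ?case
    using step falling_ratio_decrement_le[of k] by simp
qed

text \<open>The Bernstein weights are binomial probabilities with total mass 1 and mean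
  \<open>r * s\<close>. The affine bound averages to \<open>falling_ratio t r + 1 - s\<close>, and
  the added \<open>s\<close> cancels.\<close>

lemma sum_Bernstein_falling_ratio_le:
  assumes "0 \<le> s" and "s \<le> 1"
  shows "s + (\<Sum>k\<le>r. falling_ratio t k * Bernstein r k s) \<le> 1 + falling_ratio t r"
proof -
  have "(\<Sum>k\<le>r. falling_ratio t k * Bernstein r k s)
      \<le> (\<Sum>k\<le>r. (falling_ratio t r + (real r - real k) / real r) * Bernstein r k s)"
    using assms by (intro sum_mono mult_right_mono falling_ratio_le_affine Bernstein_nonneg) auto
  also have "\<dots> = (\<Sum>k\<le>r. (falling_ratio t r + 1) * Bernstein r k s
                        - (real k * Bernstein r k s) / real r)"
    using r by (intro sum.cong) (auto simp: field_simps)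
  also have "\<dots> = (falling_ratio t r + 1) * (\<Sum>k\<le>r. Bernstein r k s)
                  - (\<Sum>k\<le>r. real k * Bernstein r k s) / real r"
    by (simp only: sum_subtractf sum_distrib_left sum_divide_distrib)
  also have "\<dots> = falling_ratio t r + 1 - s"
    using r by simp
  finally show ?thesis by simp
qed

section \<open>Evaluation of the Lagrangian\<close>

text \<open>Stated for any vertex type and any suitable graph, so that it covers both the given
  graph and the complete one; their Lagrangians agree because both have this value.\<close>

lemma lagrangian_one_r_graph:
  fixes H :: "'a hypergraph"
  assumes fin: "finite (verts H)" and H: "R_graph {1, r} H"
    and T: "T = {v. {v} \<in> edges H}" and cT: "card T = t"
    and compl: "\<And>F. F \<subseteq> T \<Longrightarrow> card F = r \<Longrightarrow> F \<in> edges H"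
  shows "lagrangian H = 1 + falling_ratio t r"
proof -
  let ?V = "verts H"
  have wf: "wf_hypergraph H" and types: "edge_types H = {1, r}"
    using H by (auto simp: R_graph_def)
  have TV: "T \<subseteq> ?V" using wf by (auto simp: T wf_hypergraph_def)
  have finT: "finite T" using TV fin by (rule finite_subset)
  have t: "t > 0" using threshold_ge r by linarith
  then have "T \<noteq> {}" using cT by auto
  then have ne: "?V \<noteq> {}" using TV by blast
  have ones: "edges_of_size H 1 = (\<lambda>v. {v}) ` T"
    by (auto simp: edges_of_size_def T card_1_singleton_iff)
  have poly: "lagrange_poly H x = (\<Sum>v\<in>T. x v) + fact r * (\<Sum>F\<in>edges_of_size H r. \<Prod>i\<in>F. x i)"
    for x :: "'a \<Rightarrow> real"
  proof -
    have "(\<Sum>F\<in>edges_of_size H 1. \<Prod>i\<in>F. x i) = (\<Sum>v\<in>T. x v)"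
      unfolding ones by (subst sum.reindex) auto
    then show ?thesis using r by (simp add: lagrange_poly_def types)
  qed
  have sub: "edges_of_size H r \<subseteq> {F. F \<subseteq> ?V \<and> card F = r}"
    using wf by (auto simp: edges_of_size_def wf_hypergraph_def)
  have upper: "lagrange_poly H x \<le> 1 + falling_ratio t r" if x: "x \<in> weightings ?V" for x
  proof -
    let ?B = "?V - T"
    define s where "s = (\<Sum>v\<in>T. x v)"
    have nn: "0 \<le> x i" if "i \<in> ?V" for i using x that by (auto simp: weightings_def)
    have nnT: "0 \<le> x i" if "i \<in> T" for i using nn that TV by auto
    have "(\<Sum>v\<in>?V. x v) = (\<Sum>v\<in>?B. x v) + s"
      unfolding s_def using TV fin by (rule sum.subset_diff)
    then have sB: "(\<Sum>v\<in>?B. x v) = 1 - s" using x by (simp add: weightings_def)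
    have s0: "0 \<le> s" unfolding s_def using nnT by (rule sum_nonneg)
    have "0 \<le> (\<Sum>v\<in>?B. x v)" using nn by (intro sum_nonneg) auto
    then have s1: "s \<le> 1" using sB by simp
    \<comment> \<open>Weights are nonnegative, so admitting all \<open>r\<close>-subsets of the
      vertices can only increase the sum.\<close>
    have "(\<Sum>F\<in>edges_of_size H r. \<Prod>i\<in>F. x i) \<le> elem_sym ?V r x"
      unfolding elem_sym_def using fin sub nn
      by (intro sum_mono2 prod_nonneg) auto
    also have "\<dots> = elem_sym (T \<union> ?B) r x"
      using TV by (simp add: Un_absorb1)
    also have "\<dots> = (\<Sum>k\<le>r. elem_sym T k x * elem_sym ?B (r - k) x)"
      by (rule elem_sym_Un) (use finT fin in auto)
    finally have "fact r * (\<Sum>F\<in>edges_of_size H r. \<Prod>i\<in>F. x i)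
        \<le> (\<Sum>k\<le>r. fact r * (elem_sym T k x * elem_sym ?B (r - k) x))"
      by (simp add: sum_distrib_left[symmetric])
    also have "\<dots> \<le> (\<Sum>k\<le>r. falling_ratio t k * Bernstein r k s)"
    proof (rule sum_mono)
      fix k assume "k \<in> {..r}"
      then have k: "k \<le> r" by simp
      have "fact k * elem_sym T k x \<le> fact k * (real (t choose k) * (s / real t) ^ k)"
        using elem_sym_le_mean[OF finT nnT, where k = k]
        by (intro mult_left_mono) (auto simp: cT s_def)
      also have "\<dots> = falling_ratio t k * s ^ k"
        using falling_ratio_eq_binomial[OF t, of k s] by simp
      finally have 1: "fact k * elem_sym T k x \<le> falling_ratio t k * s ^ k" .
      have 2: "fact (r - k) * elem_sym ?B (r - k) x \<le> (1 - s) ^ (r - k)"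
        using fact_mult_elem_sym_le[of ?B x "r - k"] fin nn sB by simp
      \<comment> \<open>Shares \<open>fact r\<close> between the two symmetric polynomials; the
        leftover binomial coefficient completes a Bernstein polynomial.\<close>
      have f: "(fact r :: real) = real (r choose k) * fact k * fact (r - k)"
        using arg_cong[OF binomial_fact_lemma[OF k], of real] by (simp add: mult_ac)
      have "fact r * (elem_sym T k x * elem_sym ?B (r - k) x)
          = real (r choose k) * ((fact k * elem_sym T k x) * (fact (r - k) * elem_sym ?B (r - k) x))"
        unfolding f by (simp only: mult_ac)
      also have "\<dots> \<le> real (r choose k) * ((falling_ratio t k * s ^ k) * (1 - s) ^ (r - k))"
        by (intro mult_left_mono mult_mono[OF 1 2] mult_nonneg_nonneg elem_sym_nonneg)
          (use falling_ratio_bounds(1)[of k t] k threshold_ge s0 nn nnT in auto)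
      also have "\<dots> = falling_ratio t k * Bernstein r k s"
        by (simp add: Bernstein_def)
      finally show "fact r * (elem_sym T k x * elem_sym ?B (r - k) x)
          \<le> falling_ratio t k * Bernstein r k s" .
    qed
    finally have "lagrange_poly H x \<le> s + (\<Sum>k\<le>r. falling_ratio t k * Bernstein r k s)"
      by (simp add: poly s_def)
    then show ?thesis
      using sum_Bernstein_falling_ratio_le[OF s0 s1] by linarith
  qed
  \<comment> \<open>Uniform weight on \<open>T\<close> gives equality in Maclaurin's inequality and
    puts no weight outside \<open>T\<close>.\<close>
  define u :: "'a \<Rightarrow> real" where "u = (\<lambda>v. if v \<in> T then 1 / real t else 0)"
  have sumT: "(\<Sum>v\<in>T. u v) = 1"
    using t by (simp add: u_def cT)
  have "(\<Sum>v\<in>?V. u v) = (\<Sum>v\<in>T. u v)"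
    using fin TV by (intro sum.mono_neutral_right) (auto simp: u_def)
  then have uW: "u \<in> weightings ?V"
    using sumT by (auto simp: weightings_def u_def)
  have "elem_sym T r u \<le> (\<Sum>F\<in>edges_of_size H r. \<Prod>i\<in>F. u i)"
    unfolding elem_sym_def
  proof (rule sum_mono2)
    show "finite (edges_of_size H r)"
      using sub fin by (auto intro: finite_subset)
    show "{F. F \<subseteq> T \<and> card F = r} \<subseteq> edges_of_size H r"
      using compl by (auto simp: edges_of_size_def)
  qed (simp add: u_def prod_nonneg)
  then have "fact r * elem_sym T r u \<le> fact r * (\<Sum>F\<in>edges_of_size H r. \<Prod>i\<in>F. u i)"
    by (intro mult_left_mono) auto
  moreover have "elem_sym T r u = real (t choose r) * (1 / real t) ^ r"
    using elem_sym_const[OF finT, of u "1 / real t" r] by (simp add: u_def cT)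
  then have "fact r * elem_sym T r u = falling_ratio t r"
    using falling_ratio_eq_binomial[OF t, of r 1] by simp
  ultimately have "1 + falling_ratio t r \<le> lagrange_poly H u"
    by (simp add: poly sumT)
  also have "\<dots> \<le> lagrangian H"
    using lagrangian_attained(2)[OF fin ne wf uW] .
  finally show ?thesis
    using lagrangian_attained(1)[OF fin ne wf] upper by force
qed

end

section \<open>Complete subgraphs of maximum order\<close>

lemma complete_subgraph_1_iff:
  assumes "wf_hypergraph H"
  shows "complete_subgraph {1} H S \<longleftrightarrow> S \<subseteq> {v. {v} \<in> edges H}"
  using assms unfolding complete_subgraph_def wf_hypergraph_def
  by (auto simp: card_1_singleton_iff)

text \<open>Because \<open>0 \<notin> R\<close>, the empty set is a complete subgraph. The set of
  orders is thus finite and nonempty, so its \<open>Max\<close> is a genuine maximum.\<close>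

lemma max_complete_order_attained:
  assumes "finite (verts H)" and "0 \<notin> R"
  shows "\<exists>S. complete_subgraph R H S \<and> card S = max_complete_order R H"
    and "complete_subgraph R H S \<Longrightarrow> card S \<le> max_complete_order R H"
proof -
  let ?M = "{card S | S. complete_subgraph R H S}"
  have "?M \<subseteq> card ` Pow (verts H)"
    by (auto simp: complete_subgraph_def)
  then have fin: "finite ?M"
    using assms(1) by (meson finite_Pow_iff finite_imageI finite_subset)
  have "complete_subgraph R H {}"
    using assms(2) by (auto simp: complete_subgraph_def)
  then have "?M \<noteq> {}" by blast
  then show "\<exists>S. complete_subgraph R H S \<and> card S = max_complete_order R H"
    using Max_in[OF fin] by (auto simp: max_complete_order_def)
  show "card S \<le> max_complete_order R H" if "complete_subgraph R H S"
    unfolding max_complete_order_def using fin that by (intro Max_ge) auto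
qed

theorem theorem1p4:
  fixes r t n :: nat and H :: "nat hypergraph"
  assumes "r \<ge> 2"
    and "verts H = {1..n}"
    and "R_graph {1, r} H"
    and "max_complete_order {1, r} H = t"
    and "max_complete_order {1} H = t"
    and "int t \<ge> \<lceil>(real r * (real r - 1) - 1) ^ (r - 2) / (real r * (real r - 1)) powi (int r - 3)\<rceil>"
  shows "lagrangian H = lagrangian (complete_hypergraph {1, r} t) \<and>
         lagrangian (complete_hypergraph {1, r} t) =
           1 + (\<Prod>i=1..r - 1. real t - real i) / real t ^ (r - 1)"
proof -
  define q where "q = real r * (real r - 1)"
  have q0: "q > 0" using assms(1) by (simp add: q_def)
  \<comment> \<open>For \<open>r = 2\<close> the exponent is -1, hence the integer power. Splitting
    off one factor \<open>q\<close> leaves the natural exponent \<open>r - 2\<close>.\<close>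
  have "q powi (int r - 3) = q powi (int (r - 2) - 1)"
    using assms(1) by (simp add: of_nat_diff)
  also have "\<dots> = q ^ (r - 2) / q"
    using q0 by (simp add: power_int_diff)
  finally have "(q - 1) ^ (r - 2) / q powi (int r - 3) = q * ((q - 1) / q) ^ (r - 2)"
    by (simp add: power_divide)
  also have "(q - 1) / q = 1 - 1 / q"
    using q0 by (simp add: field_simps)
  finally have thr: "q * (1 - 1 / q) ^ (r - 2) \<le> real t"
    using assms(6) by (simp add: q_def[symmetric] ceiling_le_iff)
  note lagr = lagrangian_one_r_graph[OF assms(1) q_def thr]
  have rt: "r \<le> t" by (rule threshold_ge[OF assms(1) q_def thr])

  define T where "T = {v. {v} \<in> edges H}"
  have wf: "wf_hypergraph H" using assms(3) by (simp add: R_graph_def)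
  have finV: "finite (verts H)" using assms(2) by simp
  have finT: "finite T"
    by (rule finite_subset[OF _ finV]) (use wf in \<open>auto simp: T_def wf_hypergraph_def\<close>)
  have sub1: "complete_subgraph {1} H S \<longleftrightarrow> S \<subseteq> T" for S
    unfolding T_def by (rule complete_subgraph_1_iff[OF wf])
  obtain S1 where "S1 \<subseteq> T" "card S1 = t"
    using max_complete_order_attained(1)[OF finV, of "{1}"] assms(5) sub1 by auto
  moreover have "card T \<le> t"
    using max_complete_order_attained(2)[OF finV, of "{1}" T] assms(5) sub1 by auto
  ultimately have cT: "card T = t"
    using card_mono[OF finT] by (metis le_antisym)
  obtain S where S: "complete_subgraph {1, r} H S" "card S = t"
    using max_complete_order_attained(1)[OF finV, of "{1, r}"] assms(1,4) by auto
  \<comment> \<open>A largest complete subgraph for \<open>{1, r}\<close> lies inside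
    \<open>T\<close>; having the same size \<open>t\<close>, it is all of \<open>T\<close>.\<close>
  then have "complete_subgraph {1} H S" by (auto simp: complete_subgraph_def)
  then have "S = T" using sub1 S(2) cT finT by (simp add: card_subset_eq)
  then have "F \<in> edges H" if "F \<subseteq> T" "card F = r" for F
    using S(1) that by (auto simp: complete_subgraph_def)
  then have "lagrangian H = 1 + falling_ratio t r"
    using lagr[OF finV assms(3) T_def cT] by blast
  moreover have "lagrangian (complete_hypergraph {1, r} t) = 1 + falling_ratio t r"
  proof (rule lagr[OF _ _ refl])
    let ?K = "complete_hypergraph {1, r} t"
    show "finite (verts ?K)" by (simp add: complete_hypergraph_def)
    \<comment> \<open>Witnesses that both edge types occur; the second requires
      \<open>r \<le> t\<close>.\<close>
    have "{1..1} \<in> edges ?K" "{1..r} \<in> edges ?K"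
      using rt assms(1) by (auto simp: complete_hypergraph_def)
    then have "card {1..1::nat} \<in> edge_types ?K" "card {1..r} \<in> edge_types ?K"
      unfolding edge_types_def by blast+
    then have "edge_types ?K = {1, r}"
      by (auto simp: edge_types_def complete_hypergraph_def)
    then show "R_graph {1, r} ?K"
      by (auto simp: R_graph_def wf_hypergraph_def complete_hypergraph_def)
    have "{v. {v} \<in> edges ?K} = {1..t}"
      using assms(1) by (auto simp: complete_hypergraph_def)
    then show "card {v. {v} \<in> edges ?K} = t"
      and "\<And>F. F \<subseteq> {v. {v} \<in> edges ?K} \<Longrightarrow> card F = r \<Longrightarrow> F \<in> edges ?K"
      by (auto simp: complete_hypergraph_def)
  qed
  ultimately show ?thesis
    using falling_ratio_eq_prod[of r t] assms(1) rt by simp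
qed

end
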